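(* Let $A\in\mathbb{R}^{n\times n}$ and $b\in\mathbb{R}^n$ satisfy $\operatorname{sym}(A)\succeq I$, and suppose the solution set $S=\{x\in\mathbb{R}^n:\Phi(x)=0\}$ of $\Phi(x):=Ax-|x|-b=0$ is nonempty. Let $0<\rho<1$, $\epsilon>0$, $x^0\in\mathbb{R}^n$, and consider the CPPC method described in the context. At every nonterminal iteration $k$ (that is, every iteration reached with $R(x^k)\ne0$), $\langle v^k,d^k\rangle>0$.
   Context: $|x|$ is the componentwise absolute value; $\langle\cdot,\cdot\rangle$, $\|\cdot\|$ are the Euclidean inner product and norm; $\operatorname{sym}(A)=(A+A^\top)/2$; $I$ is the identity; $M\succeq N$ means $M-N$ is positive semidefinite. For $t\in\mathbb{R}$ put $t^-=\max\{-t,0\}$ and $g(t)=(t^-)^2$. Let $F(x)=(A-I)x-b$. Given $0<\rho<1$ and $\epsilon>0$, set $\ell_i=\max\{a_{ii}-1,\epsilon\}$ and $\gamma_i=\rho/\ell_i$ for $i=1,\dots,n$. For $\gamma>0$ and $z\in\mathbb{R}$, $\operatorname{prox}_{\gamma g}(z)=\arg\min_{t\in\mathbb{R}}\{g(t)+(2\gamma)^{-1}|t-z|^2\}$; explicitly, $\operatorname{prox}_{\gamma g}(z)=z$ if $z\ge0$ and $z/(1+2\gamma)$ if $z<0$. The coordinate proximal residual is $R(x)=(R_i(x))_{i=1}^n$ with $R_i(x)=\gamma_i^{-1}\bigl[x_i-\operatorname{prox}_{\gamma_i g}(x_i-\gamma_iF_i(x))\bigr]$. CPPC method: from an arbitrary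 $x^0\in\mathbb{R}^n$, for $k=0,1,2,\dots$: choose any $i_k\in\arg\max_{1\le i\le n}|R_i(x^k)|$. If $R_{i_k}(x^k)=0$, terminate and return $x^k$. Otherwise define $y^k$ by $y^k_j=x^k_j$ for $j\ne i_k$ and $y^k_{i_k}=\operatorname{prox}_{\gamma_{i_k}g}(x^k_{i_k}-\gamma_{i_k}F_{i_k}(x^k))$; set $d^k=x^k-y^k$, $v^k=\Phi(y^k)$, $\lambda_k=\langle v^k,d^k\rangle/\|v^k\|^2$, and $x^{k+1}=x^k-\lambda_kv^k$. *)

theory Defs
  imports "HOL-Analysis.Analysis"
begin

definition sym_part :: "real^'n^'n \<Rightarrow> real^'n^'n" where
  "sym_part A = (1/2) *\<^sub>R (A + transpose A)"

definition psd :: "real^'n^'n \<Rightarrow> bool" where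
  "psd M \<longleftrightarrow> transpose M = M \<and> (\<forall>x. 0 \<le> x \<bullet> (M *v x))"

definition loewner_ge :: "real^'n^'n \<Rightarrow> real^'n^'n \<Rightarrow> bool" (infix "\<succeq>" 50) where
  "M \<succeq> N \<longleftrightarrow> psd (M - N)"

text \<open>On \<^typ>\<open>real^'n\<close>, the library's \<^term>\<open>abs\<close> is the componentwise absolute value.\<close>

definition Phi :: "real^'n^'n \<Rightarrow> real^'n \<Rightarrow> real^'n \<Rightarrow> real^'n" where
  "Phi A b x = A *v x - \<bar>x\<bar> - b"

definition solutions :: "real^'n^'n \<Rightarrow> real^'n \<Rightarrow> (real^'n) set" where
  "solutions A b = {x. Phi A b x = 0}"

definition neg_part :: "real \<Rightarrow> real" where
  "neg_part t = max (- t) 0"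

definition g :: "real \<Rightarrow> real" where
  "g t = (neg_part t)\<^sup>2"

definition F :: "real^'n^'n \<Rightarrow> real^'n \<Rightarrow> real^'n \<Rightarrow> real^'n" where
  "F A b x = (A - mat 1) *v x - b"

definition ell :: "real^'n^'n \<Rightarrow> real \<Rightarrow> 'n \<Rightarrow> real" where
  "ell A \<epsilon> i = max (A $ i $ i - 1) \<epsilon>"

definition stepsize :: "real^'n^'n \<Rightarrow> real \<Rightarrow> real \<Rightarrow> 'n \<Rightarrow> real" where
  "stepsize A \<rho> \<epsilon> i = \<rho> / ell A \<epsilon> i"

text \<open>
  The term \<open>prox \<gamma> h z\<close> denotes the value of the proximal operator of \<open>\<gamma> h\<close> at \<open>z\<close>. As
  \<^const>\<open>arg_min\<close> picks some minimiser, this is meaningful when the minimiser exists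
  and is unique; the lemma \<open>prox_g\<close> below shows this is so for \<open>g\<close>.
\<close>

definition prox :: "real \<Rightarrow> (real \<Rightarrow> real) \<Rightarrow> real \<Rightarrow> real" where
  "prox \<gamma> h z = (ARG_MIN (\<lambda>t. h t + inverse (2 * \<gamma>) * \<bar>t - z\<bar>\<^sup>2) t. True)"

lemma is_arg_min_prox_g:
  fixes \<gamma> z t :: real
  assumes "\<gamma> > 0"
  shows "is_arg_min (\<lambda>t. g t + inverse (2 * \<gamma>) * \<bar>t - z\<bar>\<^sup>2) (\<lambda>_. True) t \<longleftrightarrow>
         t = (if z \<ge> 0 then z else z / (1 + 2 * \<gamma>))"
proof -
  define f where "f = (\<lambda>t. g t + inverse (2 * \<gamma>) * \<bar>t - z\<bar>\<^sup>2)"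
  define p where "p = (if z \<ge> 0 then z else z / (1 + 2 * \<gamma>))"
  have lower: "f p + inverse (2 * \<gamma>) * (s - p)\<^sup>2 \<le> f s" for s
  proof (cases "z \<ge> 0")
    case True
    then show ?thesis by (simp add: f_def p_def g_def neg_part_def)
  next
    case False
    have z: "z = (1 + 2 * \<gamma>) * p" using False assms by (simp add: p_def)
    have p: "p < 0" using False assms by (simp add: p_def divide_neg_pos)
    have gp: "g p = p\<^sup>2" using p by (simp add: g_def neg_part_def)
    have "p\<^sup>2 + 2 * p * (s - p) \<le> g s"
    proof (cases "s \<ge> 0")
      case True
      have "p * s \<le> 0" using p True by (simp add: mult_nonpos_nonneg)
      moreover have "p\<^sup>2 + 2 * p * (s - p) = 2 * (p * s) - p\<^sup>2"
        by (simp add: power2_eq_square algebra_simps)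
      moreover have "g s = 0" using True by (simp add: g_def neg_part_def)
      ultimately show ?thesis using zero_le_power2[of p] by linarith
    next
      case False
      have "0 \<le> (s - p)\<^sup>2" by simp
      then show ?thesis using False
        by (simp add: g_def neg_part_def power2_eq_square algebra_simps)
    qed
    moreover have "f p + inverse (2 * \<gamma>) * (s - p)\<^sup>2 =
        p\<^sup>2 + 2 * p * (s - p) + inverse (2 * \<gamma>) * (s - z)\<^sup>2"
      unfolding f_def gp using assms
      by (simp add: z field_simps power2_eq_square)
    ultimately show ?thesis by (simp add: f_def)
  qed
  have "f p < f s" if "s \<noteq> p" for s
  proof -
    have "0 < inverse (2 * \<gamma>) * (s - p)\<^sup>2" using that assms by simp
    then show ?thesis using lower[of s] by linarith
  qed
  then have "is_arg_min f (\<lambda>_. True) t \<longleftrightarrow> t = p"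
    unfolding is_arg_min_def by (metis less_asym)
  then show ?thesis by (simp add: f_def p_def)
qed

lemma prox_g:
  assumes "\<gamma> > 0"
  shows "prox \<gamma> g z = (if z \<ge> 0 then z else z / (1 + 2 * \<gamma>))"
  unfolding prox_def arg_min_def is_arg_min_prox_g[OF assms] by simp

definition residual :: "real^'n^'n \<Rightarrow> real^'n \<Rightarrow> real \<Rightarrow> real \<Rightarrow> real^'n \<Rightarrow> real^'n" where
  "residual A b \<rho> \<epsilon> x = (\<chi> i. inverse (stepsize A \<rho> \<epsilon> i) *
     (x $ i - prox (stepsize A \<rho> \<epsilon> i) g (x $ i - stepsize A \<rho> \<epsilon> i * F A b x $ i)))"

text \<open>
  The quantities computed in one iteration at the current iterate \<open>x\<close> when the coordinate
  \<open>i\<close> is selected.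
\<close>

definition cppc_y :: "real^'n^'n \<Rightarrow> real^'n \<Rightarrow> real \<Rightarrow> real \<Rightarrow> real^'n \<Rightarrow> 'n \<Rightarrow> real^'n" where
  "cppc_y A b \<rho> \<epsilon> x i = (\<chi> j. if j = i
     then prox (stepsize A \<rho> \<epsilon> i) g (x $ i - stepsize A \<rho> \<epsilon> i * F A b x $ i)
     else x $ j)"

definition cppc_d :: "real^'n^'n \<Rightarrow> real^'n \<Rightarrow> real \<Rightarrow> real \<Rightarrow> real^'n \<Rightarrow> 'n \<Rightarrow> real^'n" where
  "cppc_d A b \<rho> \<epsilon> x i = x - cppc_y A b \<rho> \<epsilon> x i"

definition cppc_v :: "real^'n^'n \<Rightarrow> real^'n \<Rightarrow> real \<Rightarrow> real \<Rightarrow> real^'n \<Rightarrow> 'n \<Rightarrow> real^'n" where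
  "cppc_v A b \<rho> \<epsilon> x i = Phi A b (cppc_y A b \<rho> \<epsilon> x i)"

definition cppc_lambda :: "real^'n^'n \<Rightarrow> real^'n \<Rightarrow> real \<Rightarrow> real \<Rightarrow> real^'n \<Rightarrow> 'n \<Rightarrow> real" where
  "cppc_lambda A b \<rho> \<epsilon> x i =
     cppc_v A b \<rho> \<epsilon> x i \<bullet> cppc_d A b \<rho> \<epsilon> x i / (norm (cppc_v A b \<rho> \<epsilon> x i))\<^sup>2"

definition cppc_next :: "real^'n^'n \<Rightarrow> real^'n \<Rightarrow> real \<Rightarrow> real \<Rightarrow> real^'n \<Rightarrow> 'n \<Rightarrow> real^'n" where
  "cppc_next A b \<rho> \<epsilon> x i = x - cppc_lambda A b \<rho> \<epsilon> x i *\<^sub>R cppc_v A b \<rho> \<epsilon> x i"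

text \<open>
  Runs are represented by total sequences of iterates \<open>x\<close> and selected coordinates \<open>i\<close>.
  Iteration \<open>k\<close> is reached iff no earlier iteration has terminated; a run constrains the
  sequences only at reached iterations, so their values after termination are arbitrary.
\<close>

definition cppc_reached :: "real^'n^'n \<Rightarrow> real^'n \<Rightarrow> real \<Rightarrow> real \<Rightarrow>
    (nat \<Rightarrow> real^'n) \<Rightarrow> (nat \<Rightarrow> 'n) \<Rightarrow> nat \<Rightarrow> bool" where
  "cppc_reached A b \<rho> \<epsilon> x i k \<longleftrightarrow> (\<forall>j<k. residual A b \<rho> \<epsilon> (x j) $ i j \<noteq> 0)"

definition cppc_run :: "real^'n^'n \<Rightarrow> real^'n \<Rightarrow> real \<Rightarrow> real \<Rightarrow> real^'n \<Rightarrow>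
    (nat \<Rightarrow> real^'n) \<Rightarrow> (nat \<Rightarrow> 'n) \<Rightarrow> bool" where
  "cppc_run A b \<rho> \<epsilon> x0 x i \<longleftrightarrow> x 0 = x0 \<and>
     (\<forall>k. cppc_reached A b \<rho> \<epsilon> x i k \<longrightarrow>
        is_arg_max (\<lambda>j. \<bar>residual A b \<rho> \<epsilon> (x k) $ j\<bar>) (\<lambda>_. True) (i k) \<and>
        (residual A b \<rho> \<epsilon> (x k) $ i k \<noteq> 0 \<longrightarrow>
           x (Suc k) = cppc_next A b \<rho> \<epsilon> (x k) (i k)))"

end

theory Submission
  imports Defs
begin

text \<open>
  Only the selected coordinate \<open>i\<close> moves, so \<open>\<langle>v, d\<rangle> = v\<^sub>i d\<^sub>i\<close>. The optimality condition of the
  proximal step says \<open>d\<^sub>i / \<gamma>\<^sub>i = F\<^sub>i(x) + y\<^sub>i - \<bar>y\<^sub>i\<bar>\<close>, while \<open>v\<^sub>i = F\<^sub>i(y) + y\<^sub>i - \<bar>y\<^sub>i\<bar>\<close> and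
  \<open>F\<^sub>i(y) = F\<^sub>i(x) - (a\<^sub>i\<^sub>i - 1) d\<^sub>i\<close>. Hence \<open>\<langle>v, d\<rangle> = (1 / \<gamma>\<^sub>i - (a\<^sub>i\<^sub>i - 1)) d\<^sub>i\<^sup>2\<close>, which is positive
  because \<open>1 / \<gamma>\<^sub>i = \<ell>\<^sub>i / \<rho> > \<ell>\<^sub>i \<ge> a\<^sub>i\<^sub>i - 1\<close> and the residual at the maximising index is nonzero.
\<close>

text \<open>First-order condition \<open>z - p = \<gamma> * g'(p)\<close> of the prox problem at its
  minimiser \<open>p\<close>: here \<open>g'(t) = 2 * min t 0 = t - \<bar>t\<bar>\<close>.\<close>

lemma prox_g_optimality:
  assumes "\<gamma> > 0"
  shows "z - prox \<gamma> g z = \<gamma> * (prox \<gamma> g z - \<bar>prox \<gamma> g z\<bar>)"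
proof (cases "z \<ge> 0")
  case True
  then show ?thesis by (simp add: prox_g[OF assms])
next
  case False
  define p where "p = prox \<gamma> g z"
  have "z = (1 + 2 * \<gamma>) * p" "p < 0"
    using False assms by (simp_all add: p_def prox_g[OF assms] divide_neg_pos)
  then have "z - p = \<gamma> * (p - \<bar>p\<bar>)" by (simp add: algebra_simps)
  then show ?thesis by (simp add: p_def)
qed

lemma ell_pos: "\<epsilon> > 0 \<Longrightarrow> 0 < ell A \<epsilon> i"
  by (simp add: ell_def less_max_iff_disj)

lemma stepsize_pos: "\<rho> > 0 \<Longrightarrow> \<epsilon> > 0 \<Longrightarrow> 0 < stepsize A \<rho> \<epsilon> i"
  by (simp add: stepsize_def ell_pos)

lemma inverse_stepsize_gt:
  assumes "0 < \<rho>" "\<rho> < 1" "\<epsilon> > 0"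
  shows "A $ i $ i - 1 < inverse (stepsize A \<rho> \<epsilon> i)"
proof -
  have "A $ i $ i - 1 \<le> ell A \<epsilon> i" by (simp add: ell_def)
  \<comment> \<open>Strict since \<rho> < 1 and the floor \<epsilon> keeps \<open>ell\<close>
    positive even if the diagonal entry is at most 1.\<close>
  also have "\<dots> < ell A \<epsilon> i / \<rho>"
    using assms ell_pos[of \<epsilon> A i] by (simp add: field_simps)
  finally show ?thesis by (simp add: stepsize_def)
qed

lemma cppc_d_eq_axis: "cppc_d A b \<rho> \<epsilon> x i = axis i (cppc_d A b \<rho> \<epsilon> x i $ i)"
  by (simp add: vec_eq_iff axis_def cppc_d_def cppc_y_def)

lemma residual_eq_cppc_d:
  "residual A b \<rho> \<epsilon> x $ i = inverse (stepsize A \<rho> \<epsilon> i) * cppc_d A b \<rho> \<epsilon> x i $ i"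
  by (simp add: residual_def cppc_d_def cppc_y_def)

text \<open>Shifting the identity from \<open>A\<close> to the absolute value exposes the same term
  \<open>t - \<bar>t\<bar>\<close> as in the prox optimality condition.\<close>

lemma Phi_nth: "Phi A b x $ i = F A b x $ i + (x $ i - \<bar>x $ i\<bar>)"
  by (simp add: Phi_def F_def matrix_vector_mult_diff_rdistrib abs_vec_def)

lemma F_diff_axis_nth:
  fixes A :: "real^'n^'n"
  shows "F A b (x - axis i c) $ i = F A b x $ i - (A $ i $ i - 1) * c"
proof -
  have "(M *v axis i c) $ i = M $ i $ i * c" for M :: "real^'n^'n"
    by (simp add: matrix_vector_mult_def axis_def if_distrib cong: if_cong)
  then show ?thesis
    by (simp add: F_def matrix_vector_mult_diff_distrib mat_def)
qed

lemma cppc_v_inner_cppc_d: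
  assumes "\<rho> > 0" "\<epsilon> > 0"
  shows "cppc_v A b \<rho> \<epsilon> x i \<bullet> cppc_d A b \<rho> \<epsilon> x i =
    (inverse (stepsize A \<rho> \<epsilon> i) - (A $ i $ i - 1)) * (cppc_d A b \<rho> \<epsilon> x i $ i)\<^sup>2"
proof -
  define y where "y = cppc_y A b \<rho> \<epsilon> x i"
  define \<delta> where "\<delta> = cppc_d A b \<rho> \<epsilon> x i $ i"
  define \<gamma> where "\<gamma> = stepsize A \<rho> \<epsilon> i"
  have \<gamma>: "\<gamma> > 0" using assms by (simp add: \<gamma>_def stepsize_pos)
  have d: "cppc_d A b \<rho> \<epsilon> x i = axis i \<delta>"
    unfolding \<delta>_def by (rule cppc_d_eq_axis)
  have y: "y = x - axis i \<delta>"
    using d by (simp add: y_def cppc_d_def algebra_simps)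
  have "x $ i - \<gamma> * F A b x $ i - y $ i = \<gamma> * (y $ i - \<bar>y $ i\<bar>)"
    using prox_g_optimality[OF \<gamma>] by (simp add: y_def cppc_y_def \<gamma>_def)
  moreover have "y $ i = x $ i - \<delta>" by (simp add: y)
  ultimately have "\<delta> = \<gamma> * (F A b x $ i + (y $ i - \<bar>y $ i\<bar>))"
    unfolding distrib_left by linarith
  then have "inverse \<gamma> * \<delta> = F A b x $ i + (y $ i - \<bar>y $ i\<bar>)"
    using \<gamma> by (simp add: field_simps)
  then have "Phi A b y $ i = (inverse \<gamma> - (A $ i $ i - 1)) * \<delta>"
    using F_diff_axis_nth[of A b x i \<delta>] by (simp add: Phi_nth y[symmetric] algebra_simps)
  then show ?thesis
    by (simp add: cppc_v_def y_def[symmetric] d inner_axis \<gamma>_def[symmetric]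
        power2_eq_square mult.assoc)
qed

theorem lemma4p1:
  fixes A :: "real^'n^'n" and b x0 :: "real^'n" and \<rho> \<epsilon> :: real
    and x :: "nat \<Rightarrow> real^'n" and i :: "nat \<Rightarrow> 'n" and k :: nat
  assumes "sym_part A \<succeq> mat 1"
    and "solutions A b \<noteq> {}"
    and "0 < \<rho>" and "\<rho> < 1" and "\<epsilon> > 0"
    and "cppc_run A b \<rho> \<epsilon> x0 x i"
    and "cppc_reached A b \<rho> \<epsilon> x i k"
    and "residual A b \<rho> \<epsilon> (x k) \<noteq> 0"
  shows "cppc_v A b \<rho> \<epsilon> (x k) (i k) \<bullet> cppc_d A b \<rho> \<epsilon> (x k) (i k) > 0"
proof -
  let ?R = "residual A b \<rho> \<epsilon> (x k)" and ?\<delta> = "cppc_d A b \<rho> \<epsilon> (x k) (i k) $ i k"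
  \<comment> \<open>A run fixes the choice of \<open>i k\<close> only at reached iterations.\<close>
  have max: "\<bar>?R $ j\<bar> \<le> \<bar>?R $ i k\<bar>" for j
    using assms(6,7) by (auto simp: cppc_run_def is_arg_max_linorder)
  obtain j where "?R $ j \<noteq> 0"
    using assms(8) by (auto simp: vec_eq_iff)
  then have "?R $ i k \<noteq> 0"
    using max[of j] by auto
  then have "?\<delta> \<noteq> 0"
    by (auto simp: residual_eq_cppc_d)
  then show ?thesis
    using inverse_stepsize_gt[OF assms(3-5), of A "i k"] assms(3,5)
    by (simp add: cppc_v_inner_cppc_d)
qed

end
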